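(* Let $d\ge 2$ be an integer, let $\boldsymbol{\omega}\in\mathbb{R}^d$ with $\|\boldsymbol{\omega}\|=1$, let $L_{\boldsymbol{\omega}}=\{t\boldsymbol{\omega}: t\in[0,1]\}$, and let $\mu_{\boldsymbol{\omega}}$ be the (one-dimensional) Lebesgue measure on $L_{\boldsymbol{\omega}}$. For any complex sequence $\mathbf{a}=(a_n)_{n=1}^\infty$ with $a_n=n^{o(1)}$ and for $\mu_{\boldsymbol{\omega}}$-almost all $\mathbf{x}\in L_{\boldsymbol{\omega}}$ one has $$|S_{\mathbf{a},d}(\mathbf{x};N)|\le N^{1/2+o(1)},\qquad N\to\infty.$$
   Context: $\|\cdot\|$ is the Euclidean norm, $\mathbf{e}(x)=\exp(2\pi i x)$. For $\mathbf{x}=(x_1,\ldots,x_d)\in\mathbb{R}^d$ and $N\in\mathbb{N}$, $S_{\mathbf{a},d}(\mathbf{x};N)=\sum_{n=1}^N a_n\,\mathbf{e}(x_1n+x_2n^2+\ldots+x_dn^d)$. $U=V^{o(1)}$ means that for every $\varepsilon>0$, $|U|\le V^{\varepsilon}$ once $V$ is large enough; $A(N)\le N^{c+o(1)}$ means that for every $\varepsilon>0$, $A(N)\le N^{c+\varepsilon}$ for all sufficiently large $N$ (how large may depend on $\mathbf{x}$). *)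

theory Defs
  imports "HOL-Analysis.Analysis"
begin

text \<open>
  A point of \<open>\<real>\<^sup>d\<close> is an extensional function on the index set \<open>{1..d}\<close>, so that the dimension
  is an ordinary natural number and the coordinates are numbered as in the exponents
  \<open>x 1 * n + \<dots> + x d * n ^ d\<close>. These are the points of the product space
  \<open>\<Pi>\<^sub>M i\<in>{1..d}. borel\<close>, whose \<open>\<sigma>\<close>-algebra is the Borel \<open>\<sigma>\<close>-algebra of \<open>\<real>\<^sup>d\<close>.
\<close>

definition vecs :: "nat \<Rightarrow> (nat \<Rightarrow> real) set" where
  "vecs d = {1..d} \<rightarrow>\<^sub>E (UNIV :: real set)"

definition vec_norm :: "nat \<Rightarrow> (nat \<Rightarrow> real) \<Rightarrow> real" where
  "vec_norm d x = L2_set x {1..d}"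

definition vec_scale :: "nat \<Rightarrow> real \<Rightarrow> (nat \<Rightarrow> real) \<Rightarrow> (nat \<Rightarrow> real)" where
  "vec_scale d t x = (\<lambda>i\<in>{1..d}. t * x i)"

definition seg :: "nat \<Rightarrow> (nat \<Rightarrow> real) \<Rightarrow> (nat \<Rightarrow> real) set" where
  "seg d \<omega> = (\<lambda>t. vec_scale d t \<omega>) ` {0..1}"

text \<open>
  One-dimensional Lebesgue measure on the segment. If \<open>vec_norm d \<omega> = 1\<close>, then \<open>t \<mapsto> t\<omega>\<close> is an
  isometry of \<open>[0,1]\<close> onto the segment, so the measure is the image of Lebesgue measure on
  \<open>[0,1]\<close>, taken on the Borel sets of the segment and then completed.
\<close>

definition seg_measure :: "nat \<Rightarrow> (nat \<Rightarrow> real) \<Rightarrow> (nat \<Rightarrow> real) measure" where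
  "seg_measure d \<omega> =
     completion (distr (lebesgue_on {0..1}) (restrict_space (\<Pi>\<^sub>M i\<in>{1..d}. borel) (seg d \<omega>))
                       (\<lambda>t. vec_scale d t \<omega>))"

definition expi :: "real \<Rightarrow> complex" where
  "expi x = exp (2 * of_real pi * \<i> * of_real x)"

definition weyl_sum :: "(nat \<Rightarrow> complex) \<Rightarrow> nat \<Rightarrow> (nat \<Rightarrow> real) \<Rightarrow> nat \<Rightarrow> complex" where
  "weyl_sum a d x N = (\<Sum>n=1..N. a n * expi (\<Sum>i=1..d. x i * real n ^ i))"

text \<open>\<open>a\<^sub>n = n\<^bsup>o(1)\<^esup>\<close>\<close>
definition subpolynomial :: "(nat \<Rightarrow> complex) \<Rightarrow> bool" where
  "subpolynomial a \<longleftrightarrow>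
     (\<forall>\<epsilon>>0. eventually (\<lambda>n. norm (a n) \<le> real n powr \<epsilon>) sequentially)"

text \<open>\<open>A(N) \<le> N\<^bsup>c + o(1)\<^esup>\<close>\<close>
definition le_powr_o1 :: "(nat \<Rightarrow> real) \<Rightarrow> real \<Rightarrow> bool" where
  "le_powr_o1 A c \<longleftrightarrow>
     (\<forall>\<epsilon>>0. eventually (\<lambda>N. A N \<le> real N powr (c + \<epsilon>)) sequentially)"

lemma measurable_vec_scale:
  "(\<lambda>t. vec_scale d t \<omega>) \<in> lebesgue_on {0..1} \<rightarrow>\<^sub>M restrict_space (\<Pi>\<^sub>M i\<in>{1..d}. borel) (seg d \<omega>)"
proof (rule measurable_restrict_space2)
  show "(\<lambda>t. vec_scale d t \<omega>) \<in> space (lebesgue_on {0..1}) \<rightarrow> seg d \<omega>"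
    by (auto simp: seg_def)
  have "(\<lambda>t. vec_scale d t \<omega>) \<in> borel \<rightarrow>\<^sub>M (\<Pi>\<^sub>M i\<in>{1..d}. borel)"
    unfolding vec_scale_def by measurable
  then show "(\<lambda>t. vec_scale d t \<omega>) \<in> lebesgue_on {0..1} \<rightarrow>\<^sub>M (\<Pi>\<^sub>M i\<in>{1..d}. borel)"
    by (intro measurable_restrict_space1 measurable_completion) simp
qed

lemma space_seg_measure: "space (seg_measure d \<omega>) = seg d \<omega>"
  by (auto simp: seg_measure_def space_restrict_space space_PiM seg_def vec_scale_def)

lemma emeasure_seg_measure_space: "emeasure (seg_measure d \<omega>) (seg d \<omega>) = 1"
proof -
  let ?R = "restrict_space (\<Pi>\<^sub>M i\<in>{1..d}. borel) (seg d \<omega>) :: (nat \<Rightarrow> real) measure"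
  let ?f = "\<lambda>t. vec_scale d t \<omega>"
  let ?D = "distr (lebesgue_on {0..1}) ?R ?f"
  have R: "space ?R = seg d \<omega>"
    by (auto simp: space_restrict_space space_PiM seg_def vec_scale_def)
  have mem: "seg d \<omega> \<in> sets ?R"
    using sets.top[of ?R] unfolding R .
  have "emeasure (seg_measure d \<omega>) (seg d \<omega>) = emeasure ?D (seg d \<omega>)"
    unfolding seg_measure_def using mem by simp
  also have "\<dots> = emeasure (lebesgue_on {0..1})
      (?f -` seg d \<omega> \<inter> space (lebesgue_on {0..1}))"
    by (rule emeasure_distr[OF measurable_vec_scale mem])
  also have "?f -` seg d \<omega> \<inter> space (lebesgue_on {0..1}) = {0..1}"
    by (auto simp: seg_def)
  also have "emeasure (lebesgue_on {0..1}) {0..1::real} = 1"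
    by (subst emeasure_restrict_space) auto
  finally show ?thesis .
qed

end

theory Submission
  imports Defs "HOL-Computational_Algebra.Polynomial" "HOL-Real_Asymp.Real_Asymp"
begin

text \<open>
  On the segment the phase is \<open>t * P n\<close> for a fixed nonconstant real polynomial \<open>P\<close>, whose values at
  large integers satisfy \<open>\<bar>P n - P m\<bar> \<ge> c * \<bar>n - m\<bar>\<close>. Hence
  \<open>\<integral>\<^sub>0\<^sup>1 expi (t * (P n - P m)) dt\<close> is \<open>O (1 / (1 + \<bar>n - m\<bar>))\<close>, so the second moment over \<open>t\<close> of a
  block of \<open>L\<close> terms is at most \<open>L\<^bsup>1 + o(1)\<^esup>\<close> times the square of the largest coefficient. The
  Rademacher-Menshov dyadic argument turns this into the same bound, up to logarithms, for the maximal
  partial sum, and a Borel-Cantelli argument over \<open>N \<le> 2 ^ k\<close> concludes.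
\<close>

section \<open>Dyadic blocks and maximal partial sums\<close>

text \<open>
  The squared blocks of the binary subdivision of \<open>{s..<s + 2 ^ k}\<close>, summed over all scales
  (of the two halves of a block only the left one is needed).
\<close>
fun dyadic_energy :: "(nat \<Rightarrow> complex) \<Rightarrow> nat \<Rightarrow> nat \<Rightarrow> real" where
  "dyadic_energy f 0 s = (norm (f s))\<^sup>2"
| "dyadic_energy f (Suc k) s =
     dyadic_energy f k s + dyadic_energy f k (s + 2 ^ k) + (norm (\<Sum>n = s..<s + 2 ^ k. f n))\<^sup>2"

lemma dyadic_energy_nonneg: "dyadic_energy f k s \<ge> 0"
  by (induction k arbitrary: s) auto

text \<open>Cauchy-Schwarz with weights \<open>K\<close> and \<open>1\<close>: the two sides differ
  by the square \<open>(x - K * y)^2 / K\<close>. The weights are chosen for an induction in which a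
  loss factor \<open>K\<close> on \<open>x\<close> may grow only to \<open>K + 1\<close>.\<close>

lemma power2_add_le_weighted:
  fixes x y K :: real
  assumes "K > 0"
  shows "(x + y)\<^sup>2 \<le> (K + 1) * (x\<^sup>2 / K + y\<^sup>2)"
proof -
  have "0 \<le> (x - K * y)\<^sup>2 / K"
    using assms by simp
  also have "\<dots> = (K + 1) * (x\<^sup>2 / K + y\<^sup>2) - (x + y)\<^sup>2"
    using assms by (simp add: field_simps power2_eq_square)
  finally show ?thesis by simp
qed

text \<open>Rademacher-Menshov: a prefix passing the midpoint is the full left half followed by a
  prefix of the right half. The weighted inequality with \<open>K = k + 1\<close> absorbs the factor
  that the induction hypothesis puts on the second piece, so each new scale raises the loss by only
  1. The right-hand side does not depend on \<open>N\<close>, which makes the bound a maximal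
  one.\<close>

lemma partial_sum_le_dyadic_energy:
  assumes "N \<le> 2 ^ k"
  shows "(norm (\<Sum>n = s..<s + N. f n))\<^sup>2 \<le> (real k + 1) * dyadic_energy f k s"
  using assms
proof (induction k arbitrary: s N)
  case 0
  then have "N = 0 \<or> N = 1" by auto
  then show ?case by auto
next
  case (Suc k)
  show ?case
  proof (cases "N \<le> 2 ^ k")
    case True
    have "(norm (\<Sum>n = s..<s + N. f n))\<^sup>2 \<le> (real k + 1) * dyadic_energy f k s"
      by (rule Suc.IH[OF True])
    also have "\<dots> \<le> (real (Suc k) + 1) * dyadic_energy f (Suc k) s"
      using dyadic_energy_nonneg[of f k s] dyadic_energy_nonneg[of f k "s + 2 ^ k"]
      by (intro mult_mono) auto
    finally show ?thesis .
  next
    case False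
    define M where "M = N - 2 ^ k"
    have M: "M \<le> 2 ^ k" "N = 2 ^ k + M"
      using False Suc.prems by (auto simp: M_def)
    let ?x = "norm (\<Sum>n = s + 2 ^ k..<s + 2 ^ k + M. f n)"
    let ?y = "norm (\<Sum>n = s..<s + 2 ^ k. f n)"
    have "(\<Sum>n = s..<s + N. f n) =
          (\<Sum>n = s..<s + 2 ^ k. f n) + (\<Sum>n = s + 2 ^ k..<s + 2 ^ k + M. f n)"
      unfolding M(2) by (subst sum.atLeastLessThan_concat) (auto simp: add.assoc)
    then have "norm (\<Sum>n = s..<s + N. f n) \<le> ?x + ?y"
      by (metis add.commute norm_triangle_ineq)
    then have "(norm (\<Sum>n = s..<s + N. f n))\<^sup>2 \<le> (?x + ?y)\<^sup>2"
      by (intro power_mono) auto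
    also have "\<dots> \<le> (real k + 1 + 1) * (?x\<^sup>2 / (real k + 1) + ?y\<^sup>2)"
      by (rule power2_add_le_weighted) auto
    also have "\<dots> \<le> (real k + 1 + 1) * (dyadic_energy f k (s + 2 ^ k) + ?y\<^sup>2)"
      using Suc.IH[OF M(1), of "s + 2 ^ k"]
      by (intro mult_left_mono add_right_mono) (auto simp: divide_le_eq mult.commute)
    also have "\<dots> \<le> (real (Suc k) + 1) * dyadic_energy f (Suc k) s"
      using dyadic_energy_nonneg[of f k s] dyadic_energy_nonneg[of f k "s + 2 ^ k"]
      by (intro mult_mono) auto
    finally show ?thesis .
  qed
qed

section \<open>Oscillatory integrals and second moments\<close>

lemma norm_expi [simp]: "norm (expi x) = 1"
  by (simp add: expi_def norm_exp_eq_Re)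

lemma expi_mult_cnj: "expi x * cnj (expi y) = expi (x - y)"
  by (simp add: expi_def exp_cnj flip: exp_add) (simp add: algebra_simps)

lemma continuous_on_expi [continuous_intros]:
  "continuous_on S g \<Longrightarrow> continuous_on S (\<lambda>x. expi (g x))"
  unfolding expi_def by (intro continuous_intros)

text \<open>The antiderivative is explicit: the integral equals \<open>(exp w - 1) / w\<close> with
  \<open>w\<close> purely imaginary, so the numerator has norm at most 2.\<close>

lemma norm_integral_expi_le:
  fixes \<delta> :: real
  assumes "\<delta> \<noteq> 0"
  shows "norm (integral {0..1} (\<lambda>t. expi (t * \<delta>))) \<le> 1 / (pi * \<bar>\<delta>\<bar>)"
proof -
  define w where "w = 2 * of_real pi * \<i> * of_real \<delta>"
  have w: "w \<noteq> 0" using assms by (simp add: w_def)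
  have e: "expi (t * \<delta>) = exp (w * of_real t)" for t
    by (simp add: expi_def w_def mult_ac)
  have "((\<lambda>t. exp (w * of_real t)) has_integral
          (exp (w * of_real 1) / w - exp (w * of_real 0) / w)) {0..1}"
  proof (rule fundamental_theorem_of_calculus)
    fix t :: real
    have "((\<lambda>z. exp (w * z) / w) has_field_derivative exp (w * of_real t)) (at (of_real t))"
      using w by (auto intro!: derivative_eq_intros)
    then show "((\<lambda>t. exp (w * of_real t) / w) has_vector_derivative exp (w * of_real t))
               (at t within {0..1})"
      by (rule has_vector_derivative_real_field)
  qed auto
  then have "integral {0..1} (\<lambda>t. expi (t * \<delta>)) = (exp w - 1) / w"
    unfolding e by (subst integral_unique) (auto simp: diff_divide_distrib)
  moreover have "norm (exp w - 1) \<le> 2"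
    by (rule order.trans[OF norm_triangle_ineq4]) (simp add: w_def norm_exp_eq_Re)
  moreover have "norm w = 2 * pi * \<bar>\<delta>\<bar>"
    by (simp add: w_def norm_mult)
  ultimately show ?thesis
    using assms by (simp add: norm_divide field_simps)
qed

lemma norm_integral_expi_le_1: "norm (integral {0..1} (\<lambda>t. expi (t * \<delta>))) \<le> 1"
proof -
  have "norm (integral {0..1} (\<lambda>t. expi (t * \<delta>))) \<le> 1 * (1 - 0)"
    by (rule integral_bound) (auto intro!: continuous_intros)
  then show ?thesis by simp
qed

text \<open>Cutting at \<open>m = n\<close> leaves two pieces of the harmonic sum. The diagonal term
  belongs to the right piece, so the left one starts at \<open>j = 2\<close>; both are then enlarged
  to \<open>1..L\<close>.\<close>

lemma sum_inverse_dist_le: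
  assumes "n \<in> {s..<s + L}"
  shows "(\<Sum>m = s..<s + L. 1 / (1 + \<bar>real n - real m\<bar>)) \<le> 2 * harm L"
proof -
  have "(\<Sum>m = s..<s + L. 1 / (1 + \<bar>real n - real m\<bar>)) =
        (\<Sum>m = s..<n. 1 / (1 + \<bar>real n - real m\<bar>)) + (\<Sum>m = n..<s + L. 1 / (1 + \<bar>real n - real m\<bar>))"
    using assms by (subst sum.atLeastLessThan_concat) auto
  also have "(\<Sum>m = s..<n. 1 / (1 + \<bar>real n - real m\<bar>)) = (\<Sum>j = 2..n - s + 1. 1 / real j)"
    using assms by (intro sum.reindex_bij_witness[of _ "\<lambda>j. n + 1 - j" "\<lambda>m. n + 1 - m"]) (auto simp: of_nat_diff)
  also have "\<dots> \<le> (\<Sum>j = 1..L. 1 / real j)"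
    using assms by (intro sum_mono2) auto
  also have "(\<Sum>m = n..<s + L. 1 / (1 + \<bar>real n - real m\<bar>)) = (\<Sum>j = 1..s + L - n. 1 / real j)"
    using assms by (intro sum.reindex_bij_witness[of _ "\<lambda>j. n + j - 1" "\<lambda>m. m + 1 - n"]) (auto simp: of_nat_diff)
  also have "\<dots> \<le> (\<Sum>j = 1..L. 1 / real j)"
    using assms by (intro sum_mono2) auto
  finally show ?thesis
    by (simp add: harm_def inverse_eq_divide)
qed

lemma harm_power2_le: "harm (2 ^ k) \<le> (real k + 1 :: real)"
proof -
  \<comment> \<open>The difference \<open>harm n - ln n\<close> decreases from its value 1 at
    \<open>n = 1\<close>; the library sequence is shifted by one, hence the indices \<open>0\<close>
    and \<open>2 ^ k - 1\<close>.\<close>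
  have "harm (2 ^ k) \<le> (ln (real (2 ^ k)) + 1 :: real)"
    using decseqD[OF decseq_harm_diff_ln, of 0 "2 ^ k - 1"] by (simp add: harm_def)
  also have "ln (real (2 ^ k)) = real k * ln 2"
    by (simp add: ln_realpow)
  also have "\<dots> \<le> real k * 1"
    using ln_2_less_1 by (intro mult_left_mono) auto
  finally show ?thesis by simp
qed

text \<open>Expanding the square gives a double sum of integrals of
  \<open>expi (t * (\<phi> n - \<phi> m))\<close>. Separation of the frequencies makes them decay
  like the inverse of the distance of \<open>n\<close> and \<open>m\<close>, so each row costs only
  a harmonic sum instead of \<open>L\<close>.\<close>

lemma integral_norm_exp_sum_le:
  fixes a :: "nat \<Rightarrow> complex" and \<phi> :: "nat \<Rightarrow> real"
  assumes sep: "\<And>n m. n \<ge> s \<Longrightarrow> m \<ge> s \<Longrightarrow> \<bar>\<phi> n - \<phi> m\<bar> \<ge> c * \<bar>real n - real m\<bar>"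
    and c: "c > 0"
    and B: "\<And>n. n \<in> {s..<s + L} \<Longrightarrow> norm (a n) \<le> B"
  shows "integral {0..1} (\<lambda>t. (norm (\<Sum>n = s..<s + L. a n * expi (t * \<phi> n)))\<^sup>2)
           \<le> 2 * (1 + 1 / c) * B\<^sup>2 * real L * harm L"
proof -
  let ?I = "{s..<s + L}"
  let ?S = "\<lambda>t. \<Sum>n\<in>?I. a n * expi (t * \<phi> n)"
  \<comment> \<open>The summand 1 covers the diagonal \<open>n = m\<close>, and \<open>1 / c\<close>
    the off-diagonal pairs.\<close>
  define \<kappa> where "\<kappa> = 1 + 1 / c"
  have \<kappa>: "\<kappa> \<ge> 1" using c by (simp add: \<kappa>_def)
  have k: "norm (integral {0..1} (\<lambda>t. expi (t * (\<phi> n - \<phi> m)))) \<le> \<kappa> * (1 / (1 + \<bar>real n - real m\<bar>))"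
    if "n \<in> ?I" "m \<in> ?I" for n m
  proof (cases "n = m")
    case True
    then show ?thesis using \<kappa> norm_integral_expi_le_1[of 0] by simp
  next
    case False
    define D where "D = \<bar>real n - real m\<bar>"
    have D: "D \<ge> 1" using False by (auto simp: D_def)
    have cD: "\<bar>\<phi> n - \<phi> m\<bar> \<ge> c * D" using sep[of n m] that by (auto simp: D_def)
    have D0: "D > 0" and cD0: "c * D > 0" using c D by simp_all
    then have pos: "\<bar>\<phi> n - \<phi> m\<bar> > 0" using cD by linarith
    have "norm (integral {0..1} (\<lambda>t. expi (t * (\<phi> n - \<phi> m)))) \<le> 1 / (pi * \<bar>\<phi> n - \<phi> m\<bar>)"
      using pos by (intro norm_integral_expi_le) auto
    \<comment> \<open>Weakening \<open>pi\<close> to 2 is enough, since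
      \<open>1 + D \<le> 2 * D\<close> for \<open>D \<ge> 1\<close>.\<close>
    also have "\<dots> \<le> 1 / (2 * (c * D))"
      using cD pos c D0 pi_ge_two by (intro divide_left_mono mult_mono mult_pos_pos) auto
    also have "\<dots> \<le> 1 / (c * (1 + D))"
      using c D by (intro divide_left_mono) (auto simp: algebra_simps intro!: add_pos_pos mult_pos_pos)
    also have "\<dots> \<le> \<kappa> * (1 / (1 + D))"
    proof -
      have "1 / c * (1 / (1 + D)) \<le> \<kappa> * (1 / (1 + D))"
        using D by (intro mult_right_mono) (auto simp: \<kappa>_def)
      then show ?thesis by simp
    qed
    finally show ?thesis by (simp add: D_def)
  qed
  have "complex_of_real ((norm (?S t))\<^sup>2) =
          (\<Sum>n\<in>?I. \<Sum>m\<in>?I. a n * cnj (a m) * expi (t * (\<phi> n - \<phi> m)))" for t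
  proof -
    have "complex_of_real ((norm (?S t))\<^sup>2) = ?S t * cnj (?S t)"
      by (rule complex_norm_square)
    also have "\<dots> = (\<Sum>n\<in>?I. \<Sum>m\<in>?I. a n * cnj (a m) * (expi (t * \<phi> n) * cnj (expi (t * \<phi> m))))"
      by (simp add: sum_product mult_ac)
    finally show ?thesis by (simp add: expi_mult_cnj right_diff_distrib)
  qed
  then have "integral {0..1} (\<lambda>t. complex_of_real ((norm (?S t))\<^sup>2)) =
      (\<Sum>n\<in>?I. \<Sum>m\<in>?I. a n * cnj (a m) * integral {0..1} (\<lambda>t. expi (t * (\<phi> n - \<phi> m))))"
    by (simp add: integral_sum integrable_continuous_interval continuous_intros)
  also have "norm \<dots> \<le> (\<Sum>n\<in>?I. \<Sum>m\<in>?I. B\<^sup>2 * (\<kappa> * (1 / (1 + \<bar>real n - real m\<bar>))))"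
  proof (intro sum_norm_le)
    fix n m assume nm: "n \<in> ?I" "m \<in> ?I"
    have "norm (a n) * norm (a m) \<le> B * B"
      using B[OF nm(1)] B[OF nm(2)] by (intro mult_mono) (auto intro: order.trans[OF norm_ge_zero])
    then show "norm (a n * cnj (a m) * integral {0..1} (\<lambda>t. expi (t * (\<phi> n - \<phi> m))))
        \<le> B\<^sup>2 * (\<kappa> * (1 / (1 + \<bar>real n - real m\<bar>)))"
      unfolding norm_mult complex_mod_cnj power2_eq_square
      by (rule mult_mono[OF _ k[OF nm]]) auto
  qed
  also have "\<dots> = (\<Sum>n\<in>?I. B\<^sup>2 * \<kappa> * (\<Sum>m\<in>?I. 1 / (1 + \<bar>real n - real m\<bar>)))"
    by (simp add: sum_distrib_left mult.assoc)
  also have "\<dots> \<le> (\<Sum>n\<in>?I. B\<^sup>2 * \<kappa> * (2 * harm L))"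
    using \<kappa> by (intro sum_mono mult_left_mono sum_inverse_dist_le) auto
  also have "\<dots> = 2 * \<kappa> * B\<^sup>2 * real L * harm L"
    by simp
  also have "integral {0..1} (\<lambda>t. complex_of_real ((norm (?S t))\<^sup>2)) =
             complex_of_real (integral {0..1} (\<lambda>t. (norm (?S t))\<^sup>2))"
    by (intro integral_unique has_integral_of_real integrable_integral
        integrable_continuous_interval continuous_intros)
  finally show ?thesis
    by (simp add: \<kappa>_def)
qed

lemma continuous_on_dyadic_energy [continuous_intros]:
  assumes "\<And>n. continuous_on A (\<lambda>t. f t n)"
  shows "continuous_on A (\<lambda>t. dyadic_energy (f t) k s)"
  by (induction k arbitrary: s) (auto intro!: continuous_intros assms)

text \<open>The energy has \<open>k + 1\<close> levels, and the blocks of one level are disjoint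
  with total length at most \<open>2 ^ k\<close>. One factor \<open>k + 1\<close> therefore counts
  levels and the other bounds the harmonic sums. In the induction both halves start at or after
  \<open>s\<close>, so they inherit the separation.\<close>

lemma integral_dyadic_energy_le:
  fixes a :: "nat \<Rightarrow> complex" and \<phi> :: "nat \<Rightarrow> real"
  assumes sep: "\<And>n m. n \<ge> s \<Longrightarrow> m \<ge> s \<Longrightarrow> \<bar>\<phi> n - \<phi> m\<bar> \<ge> c * \<bar>real n - real m\<bar>"
    and c: "c > 0"
    and B: "\<And>n. n \<in> {s..<s + 2 ^ k} \<Longrightarrow> norm (a n) \<le> B"
  shows "integral {0..1} (\<lambda>t. dyadic_energy (\<lambda>n. a n * expi (t * \<phi> n)) k s)
           \<le> 2 * (1 + 1 / c) * B\<^sup>2 * (real k + 1)\<^sup>2 * 2 ^ k"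
  using sep B
proof (induction k arbitrary: s)
  case 0
  have "integral {0..1} (\<lambda>t. dyadic_energy (\<lambda>n. a n * expi (t * \<phi> n)) 0 s) = (norm (a s))\<^sup>2"
    by (simp add: norm_mult)
  also have "\<dots> \<le> 1 * B\<^sup>2"
    using 0(2)[of s] by (simp add: power_mono)
  also have "\<dots> \<le> 2 * (1 + 1 / c) * B\<^sup>2"
    using c by (intro mult_right_mono) auto
  finally show ?case by simp
next
  case (Suc k)
  define C where "C = 2 * (1 + 1 / c) * B\<^sup>2"
  have C: "C \<ge> 0" using c by (simp add: C_def)
  let ?f = "\<lambda>t n. a n * expi (t * \<phi> n)"
  have "integral {0..1} (\<lambda>t. dyadic_energy (?f t) (Suc k) s) =
      integral {0..1} (\<lambda>t. dyadic_energy (?f t) k s) +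
      integral {0..1} (\<lambda>t. dyadic_energy (?f t) k (s + 2 ^ k)) +
      integral {0..1} (\<lambda>t. (norm (\<Sum>n = s..<s + 2 ^ k. ?f t n))\<^sup>2)"
    by (simp add: integral_add integrable_add integrable_continuous_interval continuous_intros)
  also have "\<dots> \<le> C * (real k + 1)\<^sup>2 * 2 ^ k + C * (real k + 1)\<^sup>2 * 2 ^ k + C * 2 ^ k * (real k + 1)"
  proof (intro add_mono)
    show "integral {0..1} (\<lambda>t. dyadic_energy (?f t) k s) \<le> C * (real k + 1)\<^sup>2 * 2 ^ k"
      unfolding C_def by (rule Suc.IH) (use Suc.prems in auto)
    show "integral {0..1} (\<lambda>t. dyadic_energy (?f t) k (s + 2 ^ k)) \<le> C * (real k + 1)\<^sup>2 * 2 ^ k"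
      unfolding C_def by (rule Suc.IH) (use Suc.prems in auto)
    have "integral {0..1} (\<lambda>t. (norm (\<Sum>n = s..<s + 2 ^ k. ?f t n))\<^sup>2) \<le> C * real (2 ^ k) * harm (2 ^ k)"
      unfolding C_def by (rule integral_norm_exp_sum_le) (use Suc.prems c in auto)
    also have "\<dots> \<le> C * real (2 ^ k) * (real k + 1)"
      using C by (intro mult_left_mono harm_power2_le) auto
    finally show "integral {0..1} (\<lambda>t. (norm (\<Sum>n = s..<s + 2 ^ k. ?f t n))\<^sup>2) \<le> C * 2 ^ k * (real k + 1)"
      by simp
  qed
  also have "\<dots> = C * 2 ^ k * (2 * (real k + 1)\<^sup>2 + (real k + 1))"
    by (simp add: algebra_simps)
  also have "\<dots> \<le> C * 2 ^ k * (2 * (real (Suc k) + 1)\<^sup>2)"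
    using C by (intro mult_left_mono) (auto simp: power2_eq_square algebra_simps)
  finally show ?case
    by (simp add: C_def mult_ac)
qed

section \<open>Separation of polynomial values\<close>

text \<open>By the mean value theorem a lower bound on the derivative suffices. If the leading
  coefficient is positive, the derivative eventually stays above its own positive leading
  coefficient; otherwise the same is applied to \<open>- p\<close>.\<close>

lemma polynomial_separated:
  fixes p :: "real poly"
  assumes "degree p > 0"
  obtains c s where "c > 0"
    and "\<And>x y. x \<ge> s \<Longrightarrow> y \<ge> s \<Longrightarrow> \<bar>poly p x - poly p y\<bar> \<ge> c * \<bar>x - y\<bar>"
proof -
  have *: "\<exists>c s. c > 0 \<and> (\<forall>x y. s \<le> x \<and> x < y \<longrightarrow> c * (y - x) \<le> poly q y - poly q x)"
    if "degree q > 0" "lead_coeff q > 0" for q :: "real poly"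
  proof -
    have lc: "lead_coeff (pderiv q) > 0"
      using that by (simp add: degree_pderiv coeff_pderiv)
    obtain s where s: "\<And>x. x \<ge> s \<Longrightarrow> lead_coeff (pderiv q) \<le> poly (pderiv q) x"
      using poly_pinfty_gt_lc[OF lc] by blast
    have "lead_coeff (pderiv q) * (y - x) \<le> poly q y - poly q x" if "s \<le> x" "x < y" for x y
    proof -
      obtain z where z: "x < z" "poly q y - poly q x = (y - x) * poly (pderiv q) z"
        using poly_MVT[OF \<open>x < y\<close>] by blast
      then show ?thesis
        using s[of z] that by (simp add: mult.commute)
    qed
    with lc show ?thesis by blast
  qed
  have "\<exists>c s. c > 0 \<and> (\<forall>x y. s \<le> x \<and> x < y \<longrightarrow> c * (y - x) \<le> \<bar>poly p y - poly p x\<bar>)"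
  proof (cases "lead_coeff p > 0")
    case True
    with *[of p] assms show ?thesis by (meson abs_ge_self order.trans)
  next
    case False
    moreover have "lead_coeff p \<noteq> 0" using assms by auto
    ultimately have "lead_coeff p < 0" by linarith
    then have "lead_coeff (- p) > 0" by simp
    with *[of "- p"] assms obtain c s where cs: "c > 0"
      "\<And>x y. s \<le> x \<and> x < y \<Longrightarrow> c * (y - x) \<le> poly (- p) y - poly (- p) x"
      by auto
    then have "c * (y - x) \<le> \<bar>poly p y - poly p x\<bar>" if "s \<le> x \<and> x < y" for x y
      using cs(2)[OF that] by simp
    with cs(1) show ?thesis by blast
  qed
  then obtain c s where c: "c > 0"
    and cs: "\<And>x y. s \<le> x \<Longrightarrow> x < y \<Longrightarrow> c * (y - x) \<le> \<bar>poly p y - poly p x\<bar>"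
    by blast
  show ?thesis
  proof (rule that[OF c])
    fix x y assume "x \<ge> s" "y \<ge> s"
    then show "\<bar>poly p x - poly p y\<bar> \<ge> c * \<bar>x - y\<bar>"
      using cs[of x y] cs[of y x] by (cases x y rule: linorder_cases) auto
  qed
qed

section \<open>Almost everywhere bounds\<close>

text \<open>Borel-Cantelli in integral form: the series of \<open>q k t / w k\<close> has a finite
  integral, hence converges for almost all \<open>t\<close>, and so its terms are eventually below
  1.\<close>

lemma AE_eventually_le_of_summable_integral:
  fixes q :: "nat \<Rightarrow> real \<Rightarrow> real" and b w :: "nat \<Rightarrow> real"
  assumes cont: "\<And>k. continuous_on {0..1} (q k)"
    and nonneg: "\<And>k t. q k t \<ge> 0"
    and le: "\<And>k. integral {0..1} (q k) \<le> b k"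
    and w: "\<And>k. w k > 0"
    and summable: "summable (\<lambda>k. b k / w k)"
  shows "AE t in lebesgue_on {0..1}. \<forall>\<^sub>F k in sequentially. q k t \<le> w k"
proof -
  let ?M = "lebesgue_on {0..1::real}"
  have int: "integrable ?M (\<lambda>t. q k t / w k)" for k
    by (intro continuous_imp_integrable_real continuous_intros cont) (use w[of k] in auto)
  have m: "(\<lambda>t. ennreal (q k t / w k)) \<in> borel_measurable ?M" for k
    using borel_measurable_integrable[OF int[of k]] by measurable
  have b: "b k \<ge> 0" for k
    using le[of k] integral_nonneg[OF integrable_continuous_interval[OF cont[of k]]] nonneg[of k]
    by (meson order.trans)
  have "(\<integral>\<^sup>+t. ennreal (q k t / w k) \<partial>?M) \<le> ennreal (b k / w k)" for k
  proof -
    have "(\<integral>\<^sup>+t. ennreal (q k t / w k) \<partial>?M) = ennreal (\<integral>t. q k t / w k \<partial>?M)"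
      using w[of k] nonneg by (intro nn_integral_eq_integral int) auto
    also have "(\<integral>t. q k t / w k \<partial>?M) = integral {0..1} (\<lambda>t. q k t / w k)"
      by (rule lebesgue_integral_eq_integral[OF int]) auto
    also have "\<dots> = integral {0..1} (q k) / w k"
      by simp
    also have "ennreal \<dots> \<le> ennreal (b k / w k)"
      using w[of k] le[of k] by (intro ennreal_leI divide_right_mono) auto
    finally show ?thesis .
  qed
  then have "(\<Sum>k. \<integral>\<^sup>+t. ennreal (q k t / w k) \<partial>?M) \<le> (\<Sum>k. ennreal (b k / w k))"
    by (intro suminf_le) auto
  also have "\<dots> < \<infinity>"
    unfolding infinity_ennreal_def less_top[symmetric]
    using b w by (intro ennreal_suminf_neq_top summable divide_nonneg_pos)
  finally have "(\<integral>\<^sup>+t. (\<Sum>k. ennreal (q k t / w k)) \<partial>?M) \<noteq> \<infinity>"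
    unfolding nn_integral_suminf[OF m] by (rule less_imp_neq)
  then have "AE t in ?M. (\<Sum>k. ennreal (q k t / w k)) \<noteq> \<infinity>"
    by (intro nn_integral_PInf_AE borel_measurable_suminf_order m)
  then show ?thesis
  proof eventually_elim
    case (elim t)
    have "summable (\<lambda>k. q k t / w k)"
      using elim nonneg w by (intro summable_suminf_not_top) (auto simp: less_imp_le)
    then have "\<forall>\<^sub>F k in sequentially. q k t / w k < 1"
      by (intro order_tendstoD(2)[OF summable_LIMSEQ_zero]) auto
    then show ?case
      by eventually_elim (use w in \<open>simp add: divide_less_eq_1_pos less_imp_le\<close>)
  qed
qed

lemma AE_exp_sum_le:
  fixes a :: "nat \<Rightarrow> complex" and \<phi> :: "nat \<Rightarrow> real"
  assumes sep: "\<And>n m. n \<ge> s \<Longrightarrow> m \<ge> s \<Longrightarrow> \<bar>\<phi> n - \<phi> m\<bar> \<ge> c * \<bar>real n - real m\<bar>"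
    and c: "c > 0"
    and a: "subpolynomial a"
    and \<epsilon>: "\<epsilon> > 0"
  shows "AE t in lebesgue_on {0..1}. \<forall>\<^sub>F N in sequentially.
           norm (\<Sum>n = 1..N. a n * expi (t * \<phi> n)) \<le> real N powr (1 / 2 + \<epsilon>)"
proof -
  \<comment> \<open>Two \<open>\<delta>\<close> pay for the squared coefficients and a third for
    summability. The square root of \<open>2 powr (k * (1 + 3 * \<delta>))\<close> then has exponent
    \<open>1 / 2 + \<epsilon> / 2\<close> relative to \<open>2 ^ k\<close>.\<close>
  define \<delta> where "\<delta> = \<epsilon> / 3"
  have \<delta>: "\<delta> > 0" using \<epsilon> by (simp add: \<delta>_def)
  obtain n1 where n1: "\<And>n. n \<ge> n1 \<Longrightarrow> norm (a n) \<le> real n powr \<delta>"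
    using a \<delta> unfolding subpolynomial_def eventually_sequentially by blast
  \<comment> \<open>From \<open>r\<close> on, both the separation and the coefficient bound hold;
    the terms before \<open>r\<close> form a fixed finite sum.\<close>
  define r where "r = max (max s n1) 1"
  have r: "r \<ge> s" "r \<ge> n1" "r \<ge> 1" by (auto simp: r_def)
  let ?f = "\<lambda>t n. a n * expi (t * \<phi> n)"
  \<comment> \<open>Comes from \<open>n \<le> r + 2 ^ k \<le> (r + 1) * 2 ^ k\<close> on the block,
    raised to the power \<open>\<delta>\<close>.\<close>
  define A where "A = (real r + 1) powr \<delta>"
  define b where "b k = 2 * (1 + 1 / c) * A\<^sup>2 * (real k + 1)\<^sup>2 * 2 powr (k * (1 + 2 * \<delta>))" for k :: nat
  \<comment> \<open>The division cancels the factor \<open>k + 1\<close> of the maximal bound;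
    \<open>b k / w k\<close> still decays like a cubic polynomial times
    \<open>2 powr (- \<delta> * k)\<close>.\<close>
  define w where "w k = 2 powr (k * (1 + 3 * \<delta>)) / (real k + 1)" for k :: nat
  have "integral {0..1} (\<lambda>t. dyadic_energy (?f t) k r) \<le> b k" for k
  proof -
    have "norm (a n) \<le> A * 2 powr (k * \<delta>)" if "n \<in> {r..<r + 2 ^ k}" for n
    proof -
      have "norm (a n) \<le> real n powr \<delta>"
        using that r by (intro n1) auto
      also have "\<dots> \<le> ((real r + 1) * 2 powr k) powr \<delta>"
      proof (rule powr_mono2)
        have "real n \<le> real (r + 2 ^ k)"
          using that by (intro of_nat_mono) auto
        also have "\<dots> \<le> (real r + 1) * 2 ^ k"
          using mult_left_mono[of 1 "2 ^ k" "real r"] by (simp add: algebra_simps)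
        finally show "real n \<le> (real r + 1) * 2 powr k"
          by (simp add: powr_realpow)
      qed (use \<delta> in auto)
      also have "\<dots> = A * 2 powr (k * \<delta>)"
        by (simp add: A_def powr_mult powr_powr)
      finally show ?thesis .
    qed
    then have "integral {0..1} (\<lambda>t. dyadic_energy (?f t) k r)
        \<le> 2 * (1 + 1 / c) * (A * 2 powr (k * \<delta>))\<^sup>2 * (real k + 1)\<^sup>2 * 2 ^ k"
      using sep r c by (intro integral_dyadic_energy_le) auto
    also have "\<dots> = 2 * (1 + 1 / c) * A\<^sup>2 * (real k + 1)\<^sup>2 * ((2 powr (k * \<delta>))\<^sup>2 * 2 ^ k)"
      by (simp add: power_mult_distrib)
    also have "(2 powr (k * \<delta>))\<^sup>2 * 2 ^ k = (2 powr (k * (1 + 2 * \<delta>)) :: real)"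
      by (simp add: power2_eq_square algebra_simps flip: powr_realpow powr_add)
    finally show ?thesis by (simp add: b_def)
  qed
  moreover have "summable (\<lambda>k. b k / w k)"
  proof (rule summable_comparison_test_bigo)
    show "summable (\<lambda>k. norm (1 / real k ^ 2))"
      using inverse_power_summable[of 2, where 'a = real] by (simp add: inverse_eq_divide)
    have "b k / w k = 2 * (1 + 1 / c) * A\<^sup>2 * ((real k + 1) ^ 3 * 2 powr (- \<delta> * real k))" for k
    proof -
      have e: "2 powr (k * (1 + 2 * \<delta>)) = 2 powr (- \<delta> * k) * 2 powr (k * (1 + 3 * \<delta>))"
        by (simp add: algebra_simps flip: powr_add)
      show ?thesis
        unfolding b_def w_def e by (simp add: power3_eq_cube power2_eq_square)
    qed
    moreover have "(\<lambda>k. (real k + 1) ^ 3 * 2 powr (- \<delta> * real k)) \<in> O(\<lambda>k. 1 / real k ^ 2)"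
      using \<delta> by real_asymp
    ultimately show "(\<lambda>k. b k / w k) \<in> O(\<lambda>k. 1 / real k ^ 2)"
      by simp
  qed
  ultimately have "AE t in lebesgue_on {0..1}. \<forall>\<^sub>F k in sequentially. dyadic_energy (?f t) k r \<le> w k"
    by (intro AE_eventually_le_of_summable_integral)
      (auto intro!: continuous_intros dyadic_energy_nonneg simp: w_def)
  then show ?thesis
  proof eventually_elim
    case (elim t)
    then obtain k0 where k0: "\<And>k. k \<ge> k0 \<Longrightarrow> dyadic_energy (?f t) k r \<le> w k"
      unfolding eventually_sequentially by blast
    define C where "C = norm (\<Sum>n = 1..<r. ?f t n)"
    have "\<forall>\<^sub>F N in sequentially. N \<ge> max r (2 ^ k0)"
      by (rule eventually_ge_at_top)
    then have "\<forall>\<^sub>F N in sequentially. norm (\<Sum>n = 1..N. ?f t n) \<le> C + (2 * real N) powr (1 / 2 + \<epsilon> / 2)"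
    proof eventually_elim
      case (elim N)
      then have N: "N \<ge> r" "N \<ge> 2 ^ k0" "N \<ge> 1" using r by auto
      \<comment> \<open>Scale \<open>k + 1\<close> is used: its block starting at \<open>r\<close>
        contains \<open>{r..N}\<close>, while its length is at most \<open>2 * N\<close>.\<close>
      obtain k where k: "2 ^ k \<le> N" "N < 2 ^ (k + 1)"
        using ex_power_ivl1[of 2 N] N by auto
      have "2 ^ k0 < (2 :: nat) ^ (k + 1)" using k N by linarith
      then have kk0: "k + 1 \<ge> k0" by (simp only: power_strict_increasing_iff)
      have "N + 1 - r \<le> 2 ^ (k + 1)" using k by linarith
      then have "(norm (\<Sum>n = r..<r + (N + 1 - r). ?f t n))\<^sup>2 \<le>
                 (real (k + 1) + 1) * dyadic_energy (?f t) (k + 1) r"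
        by (rule partial_sum_le_dyadic_energy)
      also have "\<dots> \<le> (real (k + 1) + 1) * w (k + 1)"
        using k0[OF kk0] by (intro mult_left_mono) auto
      also have "\<dots> = 2 powr (real (k + 1) * (1 + 3 * \<delta>))"
        by (simp add: w_def)
      also have "\<dots> = (2 ^ (k + 1)) powr (1 + 3 * \<delta>)"
        by (simp only: powr_powr flip: powr_realpow)
      also have "\<dots> \<le> (2 * real N) powr (1 + 3 * \<delta>)"
        using \<delta> of_nat_mono[OF k(1), where 'a = real] by (intro powr_mono2) auto
      also have "\<dots> = ((2 * real N) powr (1 / 2 + \<epsilon> / 2))\<^sup>2"
        by (simp add: power2_eq_square \<delta>_def flip: powr_add)
      finally have "norm (\<Sum>n = r..<N + 1. ?f t n) \<le> (2 * real N) powr (1 / 2 + \<epsilon> / 2)"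
        using N by (simp add: power2_le_iff_abs_le)
      moreover have "(\<Sum>n = 1..N. ?f t n) = (\<Sum>n = 1..<r. ?f t n) + (\<Sum>n = r..<N + 1. ?f t n)"
        using r N by (subst sum.atLeastLessThan_concat) (auto simp: atLeastLessThanSuc_atLeastAtMost)
      ultimately show ?case
        unfolding C_def by (smt (verit) norm_triangle_ineq)
    qed
    \<comment> \<open>The spare \<open>\<epsilon> / 2\<close> in the exponent absorbs both the
      constant \<open>C\<close> and the factor 2.\<close>
    moreover have "\<forall>\<^sub>F N in sequentially. C + (2 * real N) powr (1 / 2 + \<epsilon> / 2) \<le> real N powr (1 / 2 + \<epsilon>)"
      using \<epsilon> by real_asymp
    ultimately show ?case
      by eventually_elim simp
  qed
qed

section \<open>Transfer to the segment\<close>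

text \<open>Countably many exponents suffice because \<open>real N powr e\<close> is monotone in
  \<open>e\<close> for \<open>N \<ge> 1\<close>. This lets the null sets be united over
  \<open>j\<close> and makes the good set measurable.\<close>

lemma le_powr_o1_iff:
  "le_powr_o1 A c \<longleftrightarrow> (\<forall>j. \<forall>\<^sub>F N in sequentially. A N \<le> real N powr (c + 1 / real (Suc j)))"
proof
  assume "le_powr_o1 A c"
  then show "\<forall>j. \<forall>\<^sub>F N in sequentially. A N \<le> real N powr (c + 1 / real (Suc j))"
    by (auto simp: le_powr_o1_def)
next
  assume *: "\<forall>j. \<forall>\<^sub>F N in sequentially. A N \<le> real N powr (c + 1 / real (Suc j))"
  show "le_powr_o1 A c"
    unfolding le_powr_o1_def
  proof (intro allI impI)
    fix \<epsilon> :: real assume "\<epsilon> > 0"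
    then obtain j where j: "1 / real (Suc j) < \<epsilon>"
      by (metis nat_approx_posE)
    show "\<forall>\<^sub>F N in sequentially. A N \<le> real N powr (c + \<epsilon>)"
      using *[rule_format, of j] eventually_ge_at_top[of 1]
    proof eventually_elim
      case (elim N)
      have "real N powr (c + 1 / real (Suc j)) \<le> real N powr (c + \<epsilon>)"
        using j elim(2) by (intro powr_mono) auto
      with elim(1) show ?case by linarith
    qed
  qed
qed

lemma measurable_weyl_sum:
  "(\<lambda>x. norm (weyl_sum a d x N)) \<in> borel_measurable (\<Pi>\<^sub>M i\<in>{1..d}. borel)"
proof -
  have [measurable]: "expi \<in> borel_measurable borel"
    by (intro borel_measurable_continuous_onI continuous_intros)
  show ?thesis unfolding weyl_sum_def by measurable
qed

theorem corollary2p17: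
  fixes d :: nat and \<omega> :: "nat \<Rightarrow> real" and a :: "nat \<Rightarrow> complex"
  assumes "d \<ge> 2"
    and "\<omega> \<in> vecs d"
    and "vec_norm d \<omega> = 1"
    and "subpolynomial a"
  shows "AE x in seg_measure d \<omega>. le_powr_o1 (\<lambda>N. norm (weyl_sum a d x N)) (1/2)"
proof -
  define p where "p = (\<Sum>i = 1..d. monom (\<omega> i) i)"
  \<comment> \<open>A unit vector has a nonzero coordinate, and its index is at least 1, so
    \<open>p\<close> is nonconstant.\<close>
  have "L2_set \<omega> {1..d} \<noteq> 0"
    using assms(3) by (simp add: vec_norm_def)
  then obtain i where i: "i \<in> {1..d}" "\<omega> i \<noteq> 0"
    by (auto simp: L2_set_eq_0_iff)
  have "coeff p i = \<omega> i"
    using i(1) by (simp add: p_def coeff_sum)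
  with i have "degree p > 0"
    using le_degree[of p i] by auto
  then obtain c s where c: "c > 0"
    and s: "\<And>x y. x \<ge> s \<Longrightarrow> y \<ge> s \<Longrightarrow> \<bar>poly p x - poly p y\<bar> \<ge> c * \<bar>x - y\<bar>"
    using polynomial_separated by blast
  obtain s' :: nat where s': "real s' \<ge> s"
    using real_arch_simple by blast
  have weyl: "weyl_sum a d (vec_scale d t \<omega>) N = (\<Sum>n = 1..N. a n * expi (t * poly p (real n)))" for t N
    by (simp add: weyl_sum_def vec_scale_def p_def poly_sum poly_monom sum_distrib_left mult.assoc)
  have "AE t in lebesgue_on {0..1}. \<forall>\<^sub>F N in sequentially.
          norm (weyl_sum a d (vec_scale d t \<omega>) N) \<le> real N powr (1 / 2 + 1 / real (Suc j))" for j
    unfolding weyl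
  proof (rule AE_exp_sum_le[where s = s' and c = c])
    show "\<bar>poly p (real n) - poly p (real m)\<bar> \<ge> c * \<bar>real n - real m\<bar>"
      if "n \<ge> s'" "m \<ge> s'" for n m
      using that s' by (intro s) linarith+
  qed (use c assms(4) in auto)
  then have ae: "AE t in lebesgue_on {0..1}. le_powr_o1 (\<lambda>N. norm (weyl_sum a d (vec_scale d t \<omega>) N)) (1/2)"
    unfolding le_powr_o1_iff AE_all_countable by blast
  have [measurable]: "(\<lambda>x. norm (weyl_sum a d x N)) \<in>
      borel_measurable (restrict_space (\<Pi>\<^sub>M i\<in>{1..d}. borel) (seg d \<omega>))" for N
    by (intro measurable_restrict_space1 measurable_weyl_sum)
  \<comment> \<open>Needed for \<open>AE_distr_iff\<close>, which pulls the claim back to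
    \<open>t\<close> in \<open>{0..1}\<close> only for a measurable set of points; the completion
    then keeps null sets null.\<close>
  have "{x \<in> space (restrict_space (\<Pi>\<^sub>M i\<in>{1..d}. borel) (seg d \<omega>)).
          le_powr_o1 (\<lambda>N. norm (weyl_sum a d x N)) (1/2)}
        \<in> sets (restrict_space (\<Pi>\<^sub>M i\<in>{1..d}. borel) (seg d \<omega>))"
    unfolding le_powr_o1_iff eventually_sequentially by measurable
  then show ?thesis
    unfolding seg_measure_def
    by (intro AE_completion) (subst AE_distr_iff[OF measurable_vec_scale], use ae in auto)
qed

end
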